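(* Let $f\in\mathcal{P}^{*}$ and let $H_{2,1}(F_f/2)=\gamma_1\gamma_3-\gamma_2^2$ be the second-order Hankel determinant of the logarithmic coefficients of $f$. Then $$\bigl|H_{2,1}(F_f/2)\bigr|\le \frac19.$$ The inequality is sharp: there is a function in $\mathcal{P}^{*}$ for which equality holds.
   Context: Let $\mathbb{D}=\{z\in\mathbb{C}:|z|<1\}$. $\mathcal{S}$ is the class of functions $f$ that are analytic and univalent (injective) in $\mathbb{D}$ with expansion $f(z)=z+\sum_{n\ge 2}a_n z^n$. A Schwarz function is an analytic $\omega:\mathbb{D}\to\mathbb{C}$ with $\omega(0)=0$ and $|\omega(z)|<1$ for all $z\in\mathbb{D}$. For $g,h$ analytic in $\mathbb{D}$, $g\prec h$ ($g$ is subordinate to $h$) means that there is a Schwarz function $\omega$ with $g(z)=h(\omega(z))$ for all $z\in\mathbb{D}$. The class $\mathcal{P}^{*}$ is $$\mathcal{P}^{*}=\{f\in\mathcal{S}: f'(z)\prec e^{z}(1+\sin z),\ z\in\mathbb{D}\}.$$ The logarithmic coefficients $\gamma_n$ of $f\in\mathcal{S}$ are defined by $F_f(z):=\log\frac{f(z)}{z}=2\sum_{n=1}^{\infty}\gamma_n z^n$, $z\in\mathbb{D}$ (branch of the logarithm vanishing at $z=0$). Explicitly, $$\gamma_1=\tfrac12 a_2,\quad \gamma_2=\tfrac12\left(a_3-\tfrac12a_2^2\right),\quad \gamma_3=\tfrac12\left(a_4-a_2a_3+\tfrac13a_2^3\right).$$ *)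

theory Defs
  imports "HOL-Complex_Analysis.Complex_Analysis"
begin

abbreviation unit_disc :: "complex set" (\<open>\<bbbD>\<close>)
  where "\<bbbD> \<equiv> ball 0 1"

(* The expansion f(z) = z + a_2 z^2 + ... amounts to f(0) = 0 and f'(0) = 1. *)
definition class_S :: "(complex \<Rightarrow> complex) set"
  where "class_S = {f. f holomorphic_on \<bbbD> \<and> inj_on f \<bbbD> \<and> f 0 = 0 \<and> deriv f 0 = 1}"

definition schwarz_function :: "(complex \<Rightarrow> complex) \<Rightarrow> bool"
  where "schwarz_function w \<longleftrightarrow>
    w holomorphic_on \<bbbD> \<and> w 0 = 0 \<and> (\<forall>z\<in>\<bbbD>. cmod (w z) < 1)"

(* The notion is only meant for g and h holomorphic on the unit disc. *)
definition subordinate :: "(complex \<Rightarrow> complex) \<Rightarrow> (complex \<Rightarrow> complex) \<Rightarrow> bool"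
    (infix \<open>\<prec>\<^sub>s\<close> 50)
  where "g \<prec>\<^sub>s h \<longleftrightarrow> (\<exists>w. schwarz_function w \<and> (\<forall>z\<in>\<bbbD>. g z = h (w z)))"

definition class_P_star :: "(complex \<Rightarrow> complex) set"
  where "class_P_star = {f \<in> class_S. deriv f \<prec>\<^sub>s (\<lambda>z. exp z * (1 + sin z))}"

(* F is the branch of log (f(z)/z) on the unit disc that vanishes at 0. The principal
   logarithm Ln would not do, as f(z)/z may cross its branch cut. The quotient f(z)/z
   itself has a removable singularity at 0, where its value is f'(0) = 1 = exp (F 0). *)
definition is_log_branch :: "(complex \<Rightarrow> complex) \<Rightarrow> (complex \<Rightarrow> complex) \<Rightarrow> bool"
  where "is_log_branch f F \<longleftrightarrow>
    F holomorphic_on \<bbbD> \<and> F 0 = 0 \<and> (\<forall>z\<in>\<bbbD> - {0}. exp (F z) = f z / z)"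

(* The choice is immaterial: for f in class_S a branch exists, and any two branches
   agree on the unit disc (lemmas ex_log_branch and log_branch_unique). *)
definition log_fun :: "(complex \<Rightarrow> complex) \<Rightarrow> complex \<Rightarrow> complex"
  where "log_fun f = (SOME F. is_log_branch f F)"

(* gamma_n: half the n-th Taylor coefficient at 0 of log_fun f;
   see lemma log_coeff_sums. *)
definition log_coeff :: "(complex \<Rightarrow> complex) \<Rightarrow> nat \<Rightarrow> complex"
  where "log_coeff f n = fps_nth (fps_expansion (log_fun f) 0) n / 2"

definition log_hankel_2_1 :: "(complex \<Rightarrow> complex) \<Rightarrow> complex"
  where "log_hankel_2_1 f = log_coeff f 1 * log_coeff f 3 - (log_coeff f 2)\<^sup>2"

lemma ex_log_branch:
  assumes "f \<in> class_S"
  shows "\<exists>F. is_log_branch f F"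
proof -
  have f: "f holomorphic_on \<bbbD>" "inj_on f \<bbbD>" "f 0 = 0" "deriv f 0 = 1"
    using assms by (auto simp: class_S_def)
  define g where "g = (\<lambda>z. if z = 0 then 1 else f z / z)"
  have hol: "g holomorphic_on \<bbbD>"
    by (rule pole_theorem_open_0[of f \<bbbD> 0 g, OF f(1)]) (auto simp: g_def f)
  have "g z \<noteq> 0" if "z \<in> \<bbbD>" for z
  proof (cases "z = 0")
    case False
    then have "f z \<noteq> f 0"
      using inj_onD[OF f(2), of z 0] that by auto
    then show ?thesis using False f(3) by (simp add: g_def)
  qed (simp add: g_def)
  then obtain h where h: "h holomorphic_on \<bbbD>" "\<And>z. z \<in> \<bbbD> \<Longrightarrow> exp (h z) = g z"
    using holomorphic_logarithm_exists[of \<bbbD> g 0] hol by (auto simp: convex_ball)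
  have "exp (h 0) = 1" using h(2)[of 0] by (simp add: g_def)
  then have "is_log_branch f (\<lambda>z. h z - h 0)"
    unfolding is_log_branch_def using h
    by (auto intro!: holomorphic_intros simp: exp_diff g_def)
  then show ?thesis by blast
qed

lemma log_branch_unique:
  assumes "is_log_branch f F" "is_log_branch f G" "z \<in> \<bbbD>"
  shows "F z = G z"
proof -
  have F: "F holomorphic_on \<bbbD>" "F 0 = 0" "\<And>z. z \<in> \<bbbD> - {0} \<Longrightarrow> exp (F z) = f z / z"
    and G: "G holomorphic_on \<bbbD>" "G 0 = 0" "\<And>z. z \<in> \<bbbD> - {0} \<Longrightarrow> exp (G z) = f z / z"
    using assms by (auto simp: is_log_branch_def)
  have eq: "exp (F w) = exp (G w)" if "w \<in> \<bbbD>" for w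
    using F(2,3) G(2,3) that by (cases "w = 0") auto
  define H where "H = (\<lambda>z. F z - G z)"
  have expH: "exp (H w) = 1" if "w \<in> \<bbbD>" for w
    using eq[OF that] by (simp add: H_def exp_diff)
  have holH: "H holomorphic_on \<bbbD>"
    unfolding H_def by (intro holomorphic_intros F G)
  have "(H has_field_derivative 0) (at w)" if w: "w \<in> \<bbbD>" for w
  proof -
    have d: "(H has_field_derivative deriv H w) (at w)"
      using holomorphic_derivI[OF holH open_ball w] .
    have "((\<lambda>z. exp (H z)) has_field_derivative exp (H w) * deriv H w) (at w)"
      using DERIV_chain2[OF DERIV_exp d] .
    moreover have "((\<lambda>z. exp (H z)) has_field_derivative 0) (at w)"
      by (rule has_field_derivative_transform_within_open[OF DERIV_const[of 1] open_ball w])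
        (simp add: expH)
    ultimately have "exp (H w) * deriv H w = 0"
      by (rule DERIV_unique)
    then show ?thesis using d by simp
  qed
  then have "H constant_on \<bbbD>"
    by (intro has_field_derivative_0_imp_constant_on) auto
  then have "H z = H 0"
    using assms(3) by (auto simp: constant_on_def)
  then show ?thesis by (simp add: H_def F G)
qed

lemma is_log_branch_log_fun:
  assumes "f \<in> class_S"
  shows "is_log_branch f (log_fun f)"
  unfolding log_fun_def using ex_log_branch[OF assms] by (rule someI_ex)

lemma log_coeff_sums:
  assumes "f \<in> class_S" "z \<in> \<bbbD>"
  shows "(\<lambda>n. 2 * log_coeff f n * z ^ n) sums log_fun f z"
proof -
  have "log_fun f holomorphic_on \<bbbD>"
    using is_log_branch_log_fun[OF assms(1)] by (simp add: is_log_branch_def)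
  from holomorphic_power_series[OF this assms(2)] show ?thesis
    by (simp add: log_coeff_def fps_expansion_def)
qed

lemma log_coeff_0:
  assumes "f \<in> class_S"
  shows "log_coeff f 0 = 0"
  using is_log_branch_log_fun[OF assms]
  by (simp add: is_log_branch_def log_coeff_def fps_expansion_def)

end

theory Submission
  imports Defs
begin

text \<open>
  Write $f'(z) = \varphi(\omega(z))$ with $\varphi(w) = e^w(1 + \sin w) = 1 + 2w + \frac32 w^2 +
  \frac12 w^3 + \ldots$ and a Schwarz function $\omega(z) = c_1 z + c_2 z^2 + c_3 z^3 + \ldots$.
  Since $f = z \exp(F_f)$, comparing Taylor coefficients turns the Hankel determinant into
  $c_1 c_3/8 + c_1^2 c_2/48 - c_1^4/96 - c_2^2/9$ (lemma log_hankel_eq).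

  The bound. Two steps of the Schur algorithm describe the coefficients of a Schwarz function:
  $c_2 = (1 - |c_1|^2) x$ and $c_3 = (1 - |c_1|^2)(y - \overline{c_1} x^2)$ with $|x| \le 1$ and
  $|y| \le 1 - |x|^2$ (lemma schwarz_function_coeffs). After the triangle inequality a polynomial
  in $|c_1|$ and $|x|$ remains; it increases in $|x|$, and at $|x| = 1$ it is largest for
  $c_1 = 0$, where it is $1/9$.

  Sharpness. For $c_1 = 0$ and $|c_2| = 1$, up to rotation, $\omega(z) = z^2$, so the candidate is
  the odd function $f(z) = \int_0^z \varphi(u^2)\,du$, and the point is that it is univalent. This
  is delicate: the image of the disc has two inlets, symmetric to each other, along the imaginary
  axis, whose sides turn by slightly more than $\pi$, so that $f$ is not even close-to-convex.
  Univalence holds all the same: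

  \<^item> In each open quadrant $f'$ stays in a half-plane: $\varphi$ maps the upper half of the disc
    into the upper half-plane (lemma Im_dominant_pos), and $z \mapsto z^2$ maps the quadrants onto
    half discs. On the axes $f'$ is positive. So $f$ is injective on each quadrant and each
    half-axis (lemma inj_on_convex_Re_deriv_pos).

  \<^item> $f$ keeps the quadrants apart: $\mathrm{Re}\, f$ has the sign of $\mathrm{Re}\, z$ and
    $\mathrm{Im}\, f$ has the sign of $\mathrm{Im}\, z$ (lemmas Re_extremal_pos and
    Im_extremal_pos). Subtracting a small multiple of $z$, the maximum principle on a half disc
    reduces this to the boundary. On the imaginary axis $\mathrm{Re}\, f$ vanishes; on the unit
    circle $\mathrm{Re}\, f(z) / \mathrm{Re}\, z$ is, up to a small error, a polynomial of degree 5
    in $\cos(2 \arg z)$. Its minimum is about $0.027$; this is the narrow place of the inlet, and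
    it forces the numerical precision used below.
\<close>

section \<open>Taylor coefficients of Schwarz functions\<close>

text \<open>
  Identities between functions on a disc are turned into identities of power series with this
  lemma, and coefficients are then compared formally.
\<close>

lemma has_fps_expansion_eq_on_ball:
  fixes f g :: "complex \<Rightarrow> complex"
  assumes "f has_fps_expansion F" "g has_fps_expansion G" "r > 0"
    and "\<And>z. z \<in> ball 0 r \<Longrightarrow> f z = g z"
  shows "F = G"
proof -
  have "eventually (\<lambda>z. f z = g z) (nhds 0)"
    using assms(3,4) by (auto simp: eventually_nhds intro!: exI[of _ "ball 0 r"])
  then have "g has_fps_expansion F"
    using assms(1) by (simp add: has_fps_expansion_cong)
  with assms(2) show ?thesis
    by (simp add: fps_expansion_unique_complex)
qed

text \<open>
  The strong maximum principle: a holomorphic function that attains its maximum modulus is constant.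
\<close>

lemma bounded_by_1_cases:
  fixes g :: "complex \<Rightarrow> complex"
  assumes hol: "g holomorphic_on ball 0 1"
    and le: "\<And>z. z \<in> ball 0 1 \<Longrightarrow> cmod (g z) \<le> 1"
  shows "(\<forall>z\<in>ball 0 1. cmod (g z) < 1) \<or> (\<forall>z\<in>ball 0 1. g z = g 0)"
proof (rule disjCI)
  assume "\<not> (\<forall>z\<in>ball 0 1. g z = g 0)"
  then have nc: "\<not> g constant_on ball 0 1"
    unfolding constant_on_def by (metis centre_in_ball zero_less_one)
  show "\<forall>z\<in>ball 0 1. cmod (g z) < 1"
  proof (rule ballI, rule ccontr)
    fix \<xi> :: complex assume \<xi>: "\<xi> \<in> ball 0 1" "\<not> cmod (g \<xi>) < 1"
    then have "cmod (g z) \<le> cmod (g \<xi>)" if "z \<in> ball 0 1" for z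
      using le[OF that] by simp
    from maximum_modulus_principle[OF hol _ _ _ _ \<xi>(1) this] nc show False
      by auto
  qed
qed

lemma schwarz_function_quotient:
  assumes "schwarz_function w"
  obtains h :: "complex \<Rightarrow> complex" where "h holomorphic_on ball 0 1"
    "\<And>z. z \<in> ball 0 1 \<Longrightarrow> w z = z * h z" "\<And>z. z \<in> ball 0 1 \<Longrightarrow> cmod (h z) \<le> 1"
proof -
  have w: "w holomorphic_on ball 0 1" "w 0 = 0" "\<And>z. cmod z < 1 \<Longrightarrow> cmod (w z) < 1"
    using assms by (auto simp: schwarz_function_def)
  obtain h where h: "h holomorphic_on ball 0 1" "\<And>z. cmod z < 1 \<Longrightarrow> w z = z * h z"
      "deriv w 0 = h 0"
    using Schwarz3[OF w(1,2)] by blast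
  show thesis
  proof (rule that[OF h(1)])
    fix z :: complex assume z: "z \<in> ball 0 1"
    then show "w z = z * h z" using h(2) by simp
    show "cmod (h z) \<le> 1"
    proof (cases "z = 0")
      case True
      then show ?thesis using Schwarz_Lemma(2)[OF w, of 0] h(3) by simp
    next
      case False
      have "cmod z * cmod (h z) \<le> cmod z"
        using Schwarz_Lemma(1)[OF w, of z] h(2)[of z] z by (simp add: norm_mult)
      then show ?thesis using False by simp
    qed
  qed
qed

text \<open>
  One step of the Schur algorithm, with the denominator of the Moebius transformation multiplied
  out. In this form the degenerate case of a unimodular constant $g$ is no exception: there
  $h = 0$ works.
\<close>

lemma schur_step:
  fixes g :: "complex \<Rightarrow> complex"
  assumes hol: "g holomorphic_on ball 0 1"
    and le: "\<And>z. z \<in> ball 0 1 \<Longrightarrow> cmod (g z) \<le> 1"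
  obtains h :: "complex \<Rightarrow> complex" where "h holomorphic_on ball 0 1" "\<And>z. z \<in> ball 0 1 \<Longrightarrow> cmod (h z) \<le> 1"
    "\<And>z. z \<in> ball 0 1 \<Longrightarrow> g z - g 0 = z * h z * (1 - cnj (g 0) * g z)"
proof -
  consider "\<forall>z\<in>ball 0 1. g z = g 0" | "\<forall>z\<in>ball 0 1. cmod (g z) < 1"
    using bounded_by_1_cases[OF hol] le by blast
  then show thesis
  proof cases
    case 1
    then have const: "g z - g 0 = 0" if "z \<in> ball 0 1" for z
      using that by (metis diff_self)
    show thesis
      by (rule that[of "\<lambda>_. 0"]) (use const in \<open>simp_all only: mult_zero_left mult_zero_right
          diff_self norm_zero zero_le_one holomorphic_on_const\<close>)
  next
    case lt: 2
    define a where "a = g 0"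
    have a: "cmod a < 1" using lt by (auto simp: a_def)
    define w where "w = Moebius_function 0 a \<circ> g"
    have "schwarz_function w"
      unfolding schwarz_function_def w_def
      using lt a by (auto intro!: holomorphic_on_compose_gen[OF hol Moebius_function_holomorphic]
          Moebius_function_norm_lt_1 simp: a_def Moebius_function_eq_zero)
    then obtain h where h: "h holomorphic_on ball 0 1"
      "\<And>z. z \<in> ball 0 1 \<Longrightarrow> w z = z * h z" "\<And>z. z \<in> ball 0 1 \<Longrightarrow> cmod (h z) \<le> 1"
      using schwarz_function_quotient by metis
    show thesis
    proof (rule that[OF h(1,3)])
      fix z :: complex assume z: "z \<in> ball 0 1"
      have "cmod (cnj a * g z) < 1 * 1"
        unfolding norm_mult using a lt z by (intro mult_strict_mono') auto
      then have "1 - cnj a * g z \<noteq> 0" by auto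
      moreover have "z * h z = (g z - a) / (1 - cnj a * g z)"
        using h(2)[OF z] by (simp add: w_def Moebius_function_simple)
      ultimately show "g z - g 0 = z * h z * (1 - cnj (g 0) * g z)"
        by (simp add: a_def)
    qed
  qed
qed

text \<open>
  The coefficients of $g$ in terms of those of the simpler function $h$. As $|h(0)| \le 1$, the
  first formula contains the Schwarz--Pick inequality $|g'(0)| \le 1 - |g(0)|^2$.
\<close>

lemma schur_step_coeffs:
  fixes g :: "complex \<Rightarrow> complex"
  assumes hol: "g holomorphic_on ball 0 1"
    and le: "\<And>z. z \<in> ball 0 1 \<Longrightarrow> cmod (g z) \<le> 1"
    and G: "g has_fps_expansion G"
  obtains h :: "complex \<Rightarrow> complex" and H where "h holomorphic_on ball 0 1" "\<And>z. z \<in> ball 0 1 \<Longrightarrow> cmod (h z) \<le> 1"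
    "h has_fps_expansion H"
    "fps_nth G 1 = (1 - (cmod (fps_nth G 0))\<^sup>2) * fps_nth H 0"
    "fps_nth G 2 = (1 - (cmod (fps_nth G 0))\<^sup>2) *
        (fps_nth H 1 - cnj (fps_nth G 0) * (fps_nth H 0)\<^sup>2)"
proof -
  obtain h where h: "h holomorphic_on ball 0 1" "\<And>z. z \<in> ball 0 1 \<Longrightarrow> cmod (h z) \<le> 1"
    and eq: "\<And>z. z \<in> ball 0 1 \<Longrightarrow> g z - g 0 = z * h z * (1 - cnj (g 0) * g z)"
    using schur_step[OF hol le] by blast
  define H where "H = fps_expansion h 0"
  have H: "h has_fps_expansion H"
    unfolding H_def by (rule has_fps_expansion_fps_expansion[OF open_ball _ h(1)]) simp
  define a where "a = fps_nth G 0"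
  have a: "a = g 0"
    using has_fps_expansion_imp_0_eq_fps_nth_0[OF G] by (simp add: a_def)
  have E: "G - fps_const a = fps_X * H * (1 - fps_const (cnj a) * G)"
    by (rule has_fps_expansion_eq_on_ball[OF _ _ zero_less_one eq])
       (auto simp: a intro!: fps_expansion_intros G H)
  have n: "of_real ((cmod a)\<^sup>2) = cnj a * a"
    using complex_norm_square[of a] by (simp add: mult.commute)
  have 1: "fps_nth G 1 = (1 - cnj a * a) * fps_nth H 0"
    using arg_cong[OF E, of "\<lambda>F. fps_nth F 1"]
    by (simp add: mult.assoc fps_mult_nth a_def algebra_simps)
  have 2: "fps_nth G 2 = (1 - cnj a * a) * (fps_nth H 1 - cnj a * (fps_nth H 0)\<^sup>2)"
  proof -
    have "fps_nth G 2 = fps_nth H 1 * (1 - cnj a * a) - fps_nth H 0 * cnj a * fps_nth G 1"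
      using arg_cong[OF E, of "\<lambda>F. fps_nth F 2"]
      by (simp add: mult.assoc fps_mult_nth a_def numeral_2_eq_2 algebra_simps)
    then show ?thesis unfolding 1 by (simp add: algebra_simps power2_eq_square)
  qed
  show thesis
    by (rule that[OF h H]) (use 1 2 n in \<open>auto simp: a_def[symmetric]\<close>)
qed

text \<open>
  The Schur algorithm is applied to $\omega(z)/z$, and once more to the function $h$ that this
  produces, whose first two coefficients are $x$ and $y$; the second step gives the bound on $y$.
\<close>

lemma schwarz_function_coeffs:
  fixes w :: "complex \<Rightarrow> complex"
  assumes "schwarz_function w" "w has_fps_expansion W"
  obtains c x y :: complex where "cmod c \<le> 1" "cmod x \<le> 1" "cmod y \<le> 1 - (cmod x)\<^sup>2" "fps_nth W 0 = 0"
    "fps_nth W 1 = c" "fps_nth W 2 = (1 - (cmod c)\<^sup>2) * x"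
    "fps_nth W 3 = (1 - (cmod c)\<^sup>2) * (y - cnj c * x\<^sup>2)"
proof -
  obtain g where g: "g holomorphic_on ball 0 1" "\<And>z. z \<in> ball 0 1 \<Longrightarrow> cmod (g z) \<le> 1"
    and eq: "\<And>z. z \<in> ball 0 1 \<Longrightarrow> w z = z * g z"
    using schwarz_function_quotient[OF assms(1)] by metis
  define G where "G = fps_expansion g 0"
  have G: "g has_fps_expansion G"
    unfolding G_def by (rule has_fps_expansion_fps_expansion[OF open_ball _ g(1)]) simp
  have W: "W = fps_X * G"
    by (rule has_fps_expansion_eq_on_ball[OF assms(2) _ zero_less_one eq])
       (auto intro!: fps_expansion_intros G)
  obtain h :: "complex \<Rightarrow> complex" and H where h: "h holomorphic_on ball 0 1" "\<And>z. z \<in> ball 0 1 \<Longrightarrow> cmod (h z) \<le> 1"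
    "h has_fps_expansion H" and GH:
    "fps_nth G 1 = (1 - (cmod (fps_nth G 0))\<^sup>2) * fps_nth H 0"
    "fps_nth G 2 = (1 - (cmod (fps_nth G 0))\<^sup>2) *
        (fps_nth H 1 - cnj (fps_nth G 0) * (fps_nth H 0)\<^sup>2)"
    using schur_step_coeffs[OF g(1) _ G] g(2) by metis
  obtain k :: "complex \<Rightarrow> complex" and K where k: "\<And>z. z \<in> ball 0 1 \<Longrightarrow> cmod (k z) \<le> 1"
    "k has_fps_expansion K" "fps_nth H 1 = (1 - (cmod (fps_nth H 0))\<^sup>2) * fps_nth K 0"
    using schur_step_coeffs[OF h] by metis
  have n0: "cmod (fps_nth G 0) \<le> 1" "cmod (fps_nth H 0) \<le> 1" "cmod (fps_nth K 0) \<le> 1"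
    using g(2)[of 0] h(2)[of 0] k(1)[of 0] has_fps_expansion_imp_0_eq_fps_nth_0[OF G]
      has_fps_expansion_imp_0_eq_fps_nth_0[OF h(3)] has_fps_expansion_imp_0_eq_fps_nth_0[OF k(2)]
    by simp_all
  have "cmod (fps_nth H 1) = \<bar>1 - (cmod (fps_nth H 0))\<^sup>2\<bar> * cmod (fps_nth K 0)"
    by (simp only: k(3) norm_mult norm_of_real)
  also have "\<bar>1 - (cmod (fps_nth H 0))\<^sup>2\<bar> = 1 - (cmod (fps_nth H 0))\<^sup>2"
    using n0(2) by (simp add: power_le_one)
  also have "\<dots> * cmod (fps_nth K 0) \<le> \<dots> * 1"
    using n0(2,3) by (intro mult_left_mono) (simp_all add: power_le_one)
  finally have H1: "cmod (fps_nth H 1) \<le> 1 - (cmod (fps_nth H 0))\<^sup>2" by simp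
  have nth: "fps_nth W 0 = 0" "fps_nth W 1 = fps_nth G 0" "fps_nth W 2 = fps_nth G 1"
    "fps_nth W 3 = fps_nth G 2"
    by (simp_all add: W)
  show thesis
    by (rule that[OF n0(1,2) H1 nth(1,2)]) (simp_all only: nth GH)
qed

section \<open>The Hankel determinant of logarithmic coefficients\<close>

lemma fps_compose_nth_upto_3:
  fixes A B :: "'a :: comm_ring_1 fps"
  assumes "fps_nth B 0 = 0"
  shows "fps_nth (A oo B) 1 = fps_nth A 1 * fps_nth B 1"
    and "fps_nth (A oo B) 2 = fps_nth A 1 * fps_nth B 2 + fps_nth A 2 * (fps_nth B 1)\<^sup>2"
    and "fps_nth (A oo B) 3 = fps_nth A 1 * fps_nth B 3
      + 2 * fps_nth A 2 * fps_nth B 1 * fps_nth B 2 + fps_nth A 3 * fps_nth B 1 ^ 3"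
  using assms
  by (simp_all add: fps_compose_nth fps_mult_nth numeral_2_eq_2 numeral_3_eq_3 algebra_simps)

text \<open>
  With $F$ the logarithm of $f(z)/z$, both sides of $(z e^{F})' = \varphi(\omega(z))$ are
  compositions of known power series with series without constant term, so the coefficients of
  $F$ up to degree 3 can be solved for one after the other.
\<close>

lemma log_hankel_eq:
  assumes f: "f \<in> class_S"
    and w: "schwarz_function w" "w has_fps_expansion W"
    and eq: "\<And>z. z \<in> ball 0 1 \<Longrightarrow> deriv f z = exp (w z) * (1 + sin (w z))"
  shows "log_hankel_2_1 f = fps_nth W 1 * fps_nth W 3 / 8 + (fps_nth W 1)\<^sup>2 * fps_nth W 2 / 48
    - fps_nth W 1 ^ 4 / 96 - (fps_nth W 2)\<^sup>2 / 9"
proof -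
  have F: "log_fun f holomorphic_on ball 0 1" "log_fun f 0 = 0"
     "\<And>z. z \<in> ball 0 1 - {0} \<Longrightarrow> exp (log_fun f z) = f z / z"
    using is_log_branch_log_fun[OF f] by (auto simp: is_log_branch_def)
  define L where "L = fps_expansion (log_fun f) 0"
  have L: "log_fun f has_fps_expansion L"
    unfolding L_def by (rule has_fps_expansion_fps_expansion[OF open_ball _ F(1)]) simp
  have L0: "fps_nth L 0 = 0"
    using has_fps_expansion_imp_0_eq_fps_nth_0[OF L] F by simp
  have W0: "fps_nth W 0 = 0"
    using has_fps_expansion_imp_0_eq_fps_nth_0[OF w(2)] w(1) by (simp add: schwarz_function_def)
  \<comment> \<open>the power series of $f(z)/z$\<close>
  define E where "E = fps_exp 1 oo L"
  have fE: "f has_fps_expansion fps_X * E"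
  proof -
    have "f holomorphic_on ball 0 1" "f 0 = 0" using f by (auto simp: class_S_def)
    then have A: "f has_fps_expansion fps_expansion f 0"
      by (intro has_fps_expansion_fps_expansion[OF open_ball]) auto
    have "(\<lambda>z. z * (exp \<circ> log_fun f) z) has_fps_expansion fps_X * E"
      unfolding E_def by (intro fps_expansion_intros L L0)
    moreover have "f z = z * (exp \<circ> log_fun f) z" if "z \<in> ball 0 1" for z
      using F(3)[of z] \<open>f 0 = 0\<close> that by (cases "z = 0") auto
    ultimately have "fps_expansion f 0 = fps_X * E"
      by (rule has_fps_expansion_eq_on_ball[OF A _ zero_less_one])
    with A show ?thesis by simp
  qed
  define H :: "complex fps" where "H = fps_exp 1 * (1 + fps_sin 1)"
  have "(\<lambda>w. exp w * (1 + sin w)) has_fps_expansion H"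
    unfolding H_def by (intro fps_expansion_intros)
  from has_fps_expansion_compose[OF this w(2) W0]
  have dE: "fps_deriv (fps_X * E) = H oo W"
    by (rule has_fps_expansion_eq_on_ball[OF has_fps_expansion_deriv[OF fE] _ zero_less_one])
       (simp add: eq)
  have H: "fps_nth H 1 = 2" "fps_nth H 2 = 3/2" "fps_nth H 3 = 1/2"
  proof -
    have "fps_nth (fps_sin (1::complex)) 0 = 0" "fps_nth (fps_sin (1::complex)) (Suc 0) = 1"
      "fps_nth (fps_sin (1::complex)) (Suc (Suc 0)) = 0"
      "fps_nth (fps_sin (1::complex)) (Suc (Suc (Suc 0))) = - 1 / 6"
      by (simp_all add: fps_sin_def fact_numeral)
    then show "fps_nth H 1 = 2" "fps_nth H 2 = 3/2" "fps_nth H 3 = 1/2"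
      by (simp_all add: H_def fps_mult_nth numeral_2_eq_2 numeral_3_eq_3)
  qed
  define c1 c2 c3 l1 l2 l3 where c: "c1 = fps_nth W 1" "c2 = fps_nth W 2" "c3 = fps_nth W 3" and
    l: "l1 = fps_nth L 1" "l2 = fps_nth L 2" "l3 = fps_nth L 3"
  have nth: "of_nat (n + 1) * fps_nth E n = fps_nth (H oo W) n" for n
    using arg_cong[OF dE, of "\<lambda>F. fps_nth F n"] by (simp add: fps_deriv_nth del: fps_deriv_mult)
  have E: "fps_nth E 1 = l1" "fps_nth E 2 = l2 + l1\<^sup>2 / 2"
    "fps_nth E 3 = l3 + l1 * l2 + l1 ^ 3 / 6"
    unfolding E_def fps_compose_nth_upto_3[OF L0] l by (simp_all add: fact_numeral)
  have "2 * l1 = 2 * c1"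
    using nth[of 1] unfolding fps_compose_nth_upto_3[OF W0] E H c by simp
  then have l1: "l1 = c1" by simp
  have "3 * (l2 + l1\<^sup>2 / 2) = 2 * c2 + 3/2 * c1\<^sup>2"
    using nth[of 2] unfolding fps_compose_nth_upto_3[OF W0] E H c by simp
  then have l2: "l2 = 2 / 3 * c2"
    unfolding l1 by (simp add: field_simps)
  have "4 * (l3 + l1 * l2 + l1 ^ 3 / 6) = 2 * c3 + 3 * c1 * c2 + c1 ^ 3 / 2"
    using nth[of 3] unfolding fps_compose_nth_upto_3[OF W0] E H c by simp
  then have l3: "l3 = c3 / 2 + c1 * c2 / 12 - c1 ^ 3 / 24"
    unfolding l1 l2 by (simp add: field_simps power3_eq_cube) algebra
  have "log_hankel_2_1 f = (l1 * l3 - l2\<^sup>2) / 4"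
    by (simp add: log_hankel_2_1_def log_coeff_def l L_def field_simps power2_eq_square)
  also have "\<dots> = c1 * c3 / 8 + c1\<^sup>2 * c2 / 48 - c1 ^ 4 / 96 - c2\<^sup>2 / 9"
    unfolding l1 l2 l3 by (simp add: field_simps power2_eq_square eval_nat_numeral)
  finally show ?thesis by (simp add: c)
qed

text \<open>
  Here $s = |c_1|$ and $r = |x|$. The coefficient of $r^2$ in the inner bracket is
  $(1 - s)(8 - s)/72 \ge 0$, so $r = 1$ is the worst case, and what is left is
  $1/9 - \frac{11}{144} s^2$ up to a non-positive multiple of $s^4$.
\<close>

lemma hankel_real_bound:
  fixes s r :: real
  assumes "0 \<le> s" "s \<le> 1" "0 \<le> r" "r \<le> 1"
  shows "(1 - s\<^sup>2) * (s * (1 - r\<^sup>2) / 8 + s\<^sup>2 * r\<^sup>2 / 8 + s\<^sup>2 * r / 48 + (1 - s\<^sup>2) * r\<^sup>2 / 9) + s ^ 4 / 96 \<le> 1 / 9"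
proof -
  have s2: "0 \<le> 1 - s\<^sup>2" using assms by (simp add: power_le_one)
  have "s * (1 - r\<^sup>2) / 8 + s\<^sup>2 * r\<^sup>2 / 8 + s\<^sup>2 * r / 48 + (1 - s\<^sup>2) * r\<^sup>2 / 9 =
     s / 8 + r\<^sup>2 * ((1 - s) * (8 - s) / 72) + s\<^sup>2 * r / 48"
    by (simp add: field_simps power2_eq_square)
  also have "\<dots> \<le> s / 8 + 1 * ((1 - s) * (8 - s) / 72) + s\<^sup>2 * 1 / 48"
    using assms by (intro add_mono mult_mono divide_right_mono mult_nonneg_nonneg order_refl) (auto simp: power_le_one)
  also have "\<dots> = 1 / 9 + 5 / 144 * s\<^sup>2"
    by (simp add: field_simps power2_eq_square)
  finally have "(1 - s\<^sup>2) * (s * (1 - r\<^sup>2) / 8 + s\<^sup>2 * r\<^sup>2 / 8 + s\<^sup>2 * r / 48 + (1 - s\<^sup>2) * r\<^sup>2 / 9)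
      \<le> (1 - s\<^sup>2) * (1 / 9 + 5 / 144 * s\<^sup>2)"
    using s2 by (rule mult_left_mono)
  also have "\<dots> = 1 / 9 - 11 / 144 * s\<^sup>2 - 5 / 144 * s ^ 4"
    by (simp add: field_simps eval_nat_numeral)
  finally show ?thesis
    using zero_le_power2[of s] zero_le_even_power[of 4 s, OF even_numeral] by linarith
qed

text \<open>
  The phase of $c$ needs no normalisation, because in the term with $c_3$ the conjugate combines
  with the factor $c_1$ to $|c|^2$.
\<close>

lemma hankel_functional_bound:
  fixes c x y :: complex
  assumes "cmod c \<le> 1" "cmod x \<le> 1" "cmod y \<le> 1 - (cmod x)\<^sup>2"
  defines "T \<equiv> 1 - complex_of_real ((cmod c)\<^sup>2)"
  shows "cmod (c * (T * (y - cnj c * x\<^sup>2)) / 8 + c\<^sup>2 * (T * x) / 48 - c ^ 4 / 96 - (T * x)\<^sup>2 / 9) \<le> 1 / 9"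
proof -
  define s r where "s = cmod c" and "r = cmod x"
  have sr: "0 \<le> s" "s \<le> 1" "0 \<le> r" "r \<le> 1" using assms by (auto simp: s_def r_def)
  have t: "0 \<le> 1 - s\<^sup>2" using sr by (simp add: power_le_one)
  have T: "T = of_real (1 - s\<^sup>2)" by (simp add: T_def s_def)
  have nT: "cmod T = 1 - s\<^sup>2" unfolding T norm_of_real using t by simp
  have cc: "c * cnj c = of_real (s\<^sup>2)"
    using complex_norm_square[of c] by (simp add: s_def)
  have eq: "c * (T * (y - cnj c * x\<^sup>2)) / 8 + c\<^sup>2 * (T * x) / 48 - c ^ 4 / 96 - (T * x)\<^sup>2 / 9 =
      T * (c * y / 8 - (c * cnj c) * x\<^sup>2 / 8 + c\<^sup>2 * x / 48 - T * x\<^sup>2 / 9) - c ^ 4 / 96"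
    by (simp add: field_simps power2_eq_square)
  have "cmod (T * (c * y / 8 - (c * cnj c) * x\<^sup>2 / 8 + c\<^sup>2 * x / 48 - T * x\<^sup>2 / 9) - c ^ 4 / 96)
      \<le> (1 - s\<^sup>2) * (s * (1 - r\<^sup>2) / 8 + s\<^sup>2 * r\<^sup>2 / 8 + s\<^sup>2 * r / 48 + (1 - s\<^sup>2) * r\<^sup>2 / 9) + s ^ 4 / 96"
  proof -
    have 1: "cmod (c * y / 8) \<le> s * (1 - r\<^sup>2) / 8"
      using assms(3) by (auto simp: norm_mult norm_divide s_def r_def intro!: mult_left_mono)
    have 2: "cmod ((c * cnj c) * x\<^sup>2 / 8) \<le> s\<^sup>2 * r\<^sup>2 / 8"
      unfolding cc by (simp add: norm_mult norm_divide norm_power r_def)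
    have 3: "cmod (c\<^sup>2 * x / 48) \<le> s\<^sup>2 * r / 48"
      by (simp add: norm_mult norm_divide norm_power r_def s_def)
    have 4: "cmod (T * x\<^sup>2 / 9) \<le> (1 - s\<^sup>2) * r\<^sup>2 / 9"
      by (simp add: norm_mult norm_divide norm_power r_def nT)
    have "cmod (c * y / 8 - (c * cnj c) * x\<^sup>2 / 8 + c\<^sup>2 * x / 48 - T * x\<^sup>2 / 9)
      \<le> s * (1 - r\<^sup>2) / 8 + s\<^sup>2 * r\<^sup>2 / 8 + s\<^sup>2 * r / 48 + (1 - s\<^sup>2) * r\<^sup>2 / 9"
      by (intro norm_triangle_le norm_triangle_le_diff add_mono 1 2 3 4)
    then have "cmod (T * (c * y / 8 - (c * cnj c) * x\<^sup>2 / 8 + c\<^sup>2 * x / 48 - T * x\<^sup>2 / 9))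
      \<le> (1 - s\<^sup>2) * (s * (1 - r\<^sup>2) / 8 + s\<^sup>2 * r\<^sup>2 / 8 + s\<^sup>2 * r / 48 + (1 - s\<^sup>2) * r\<^sup>2 / 9)"
      unfolding norm_mult nT using t by (rule mult_left_mono)
    moreover have "cmod (c ^ 4 / 96) \<le> s ^ 4 / 96"
      by (simp add: norm_divide norm_power s_def)
    ultimately show ?thesis
      by (intro norm_triangle_le_diff add_mono)
  qed
  also have "\<dots> \<le> 1 / 9"
    using sr by (rule hankel_real_bound)
  finally show ?thesis unfolding eq .
qed

section \<open>Odd functions with positive real part on a half disc\<close>

text \<open>
  The Chebyshev polynomials of the third kind,
  $V_n(\cos 2\theta) = \cos((2n+1)\theta) / \cos\theta$.
\<close>

fun chebyshev_V :: "nat \<Rightarrow> real \<Rightarrow> real" where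
  "chebyshev_V 0 c = 1"
| "chebyshev_V (Suc 0) c = 2 * c - 1"
| "chebyshev_V (Suc (Suc n)) c = 2 * c * chebyshev_V (Suc n) c - chebyshev_V n c"

text \<open>
  On the unit circle $z^4 = 2 \mathrm{Re}(z^2) z^2 - 1$, which is the recursion of the $V_n$.
\<close>

lemma Re_odd_power_unit_circle:
  assumes "cmod z = 1"
  shows "Re (z ^ (2 * n + 1)) = Re z * chebyshev_V n (Re (z\<^sup>2))"
proof (induction n rule: induct_nat_012)
  case 0
  then show ?case by simp
next
  have u: "(Re z)\<^sup>2 + (Im z)\<^sup>2 = 1"
    using assms by (simp add: cmod_def)
  case 1
  show ?case
    using u by (simp add: power3_eq_cube power2_eq_square) algebra
next
  case (ge2 n)
  have "z * cnj z = 1"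
    using assms complex_norm_square[of z] by simp
  then have "(z * z) * (cnj z * cnj z) = 1"
    by (metis mult.assoc mult.left_commute mult_1_right)
  moreover have "z * z + cnj z * cnj z = of_real (2 * Re (z\<^sup>2))"
    by (simp add: complex_eq_iff power2_eq_square)
  ultimately have "(z * z) * (z * z) = of_real (2 * Re (z\<^sup>2)) * (z * z) - 1"
    by (metis add_diff_cancel_right' distrib_left mult.commute)
  then have "z ^ (2 * n + 1) * ((z * z) * (z * z)) =
     z ^ (2 * n + 1) * (of_real (2 * Re (z\<^sup>2)) * (z * z) - 1)"
    by simp
  then have "z ^ (2 * Suc (Suc n) + 1) =
     of_real (2 * Re (z\<^sup>2)) * z ^ (2 * Suc n + 1) - z ^ (2 * n + 1)"
    by (simp add: algebra_simps)
  then have rec: "Re (z ^ (2 * Suc (Suc n) + 1)) =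
     2 * Re (z\<^sup>2) * Re (z ^ (2 * Suc n + 1)) - Re (z ^ (2 * n + 1))"
    by (simp only: minus_complex.sel times_complex.sel Re_complex_of_real Im_complex_of_real
        mult_zero_left diff_zero)
  show ?case
    unfolding rec ge2 chebyshev_V.simps by (simp only: algebra_simps)
qed

lemma Re_nonneg_half_disc:
  assumes hol: "g holomorphic_on UNIV"
    and axis: "\<And>z. Re z = 0 \<Longrightarrow> Re (g z) \<ge> 0"
    and arc: "\<And>z. cmod z = 1 \<Longrightarrow> Re z \<ge> 0 \<Longrightarrow> Re (g z) \<ge> 0"
    and z: "cmod z < 1" "Re z > 0"
  shows "Re (g z) \<ge> 0"
proof -
  define S where "S = ball 0 1 \<inter> {z. 0 < Re z}"
  have "open S"
    unfolding S_def by (intro open_Int open_ball open_halfspace_Re_gt)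
  have "closure S \<subseteq> cball 0 1 \<inter> {z. 0 \<le> Re z}"
    by (rule closure_minimal) (auto simp: S_def closed_halfspace_Re_ge intro!: closed_Int)
  then have "frontier S \<subseteq> (cball 0 1 \<inter> {z. 0 \<le> Re z}) - S"
    using \<open>open S\<close> by (auto simp: frontier_def interior_open)
  then have fr: "- Re (g z) \<le> 0" if "z \<in> frontier S" for z
    using that axis[of z] arc[of z] by (force simp: S_def)
  have "Re (- g z) \<le> 0"
  proof (rule maximum_real_frontier[of "\<lambda>z. - g z" S])
    show "(\<lambda>z. - g z) holomorphic_on interior S"
      by (intro holomorphic_intros holomorphic_on_subset[OF hol]) auto
    show "continuous_on (closure S) (\<lambda>z. - g z)"
      by (intro continuous_intros holomorphic_on_imp_continuous_on holomorphic_on_subset[OF hol]) auto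
    show "bounded S"
      unfolding S_def by (simp add: bounded_Int)
  qed (use fr z in \<open>auto simp: S_def\<close>)
  then show ?thesis by simp
qed

text \<open>
  Along the imaginary axis $df = f'\, i\, dy$ is purely imaginary.
\<close>

lemma Re_eq_0_on_imaginary_axis:
  assumes d: "\<And>z. (f has_field_derivative f' z) (at z)"
    and "f 0 = 0"
    and real: "\<And>z. Re z = 0 \<Longrightarrow> Im (f' z) = 0"
    and z: "Re z = 0"
  shows "Re (f z) = 0"
proof -
  obtain u where u: "u \<in> closed_segment 0 z" "Re (f z) - Re (f 0) = Re (f' u * (z - 0))"
    using complex_mvt_line[of 0 z f f'] d by blast
  have "Re u = 0"
    using u(1) z by (auto simp: closed_segment_def)
  then show ?thesis
    using u(2) z real[of u] \<open>f 0 = 0\<close> by simp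
qed

text \<open>
  A positivity criterion for $f(z) = \int_0^z H(u^2)\,du$ with $H$ real on the real axis. The
  primitive $P$ of the polynomial part of $H$ satisfies $\mathrm{Re}\, P = \mathrm{Re}\, z \cdot
  \sum_k \frac{a_k}{2k+1} V_k$ on the unit circle. The remainder vanishes in real part on the
  imaginary axis, so integrating horizontally from there bounds it by $\delta\, \mathrm{Re}\, z$:
  the error is proportional to $\mathrm{Re}\, z$, and the comparison does not degenerate where the
  arc meets the imaginary axis. The surplus $\epsilon$ is used to get a strict inequality out of
  the maximum principle, applied to $f(z) - \epsilon z$.
\<close>

lemma Re_pos_odd_primitive:
  fixes a :: "nat \<Rightarrow> real"
  assumes d: "\<And>z. (f has_field_derivative H (z\<^sup>2)) (at z)"
    and f0: "f 0 = 0"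
    and real: "\<And>w. Im w = 0 \<Longrightarrow> Im (H w) = 0"
    and tail: "\<And>w. cmod w \<le> 1 \<Longrightarrow> cmod (H w - (\<Sum>k\<le>n. of_real (a k) * w ^ k)) \<le> \<delta>"
    and kernel: "\<And>c. - 1 \<le> c \<Longrightarrow> c \<le> 1 \<Longrightarrow>
      \<delta> + \<epsilon> \<le> (\<Sum>k\<le>n. a k / real (2 * k + 1) * chebyshev_V k c)"
    and \<epsilon>: "\<epsilon> > 0"
    and z: "cmod z < 1" "Re z > 0"
  shows "Re (f z) > 0"
proof -
  define p where "p w = (\<Sum>k\<le>n. of_real (a k) * w ^ k)" for w :: complex
  define P where "P z = (\<Sum>k\<le>n. of_real (a k / real (2 * k + 1)) * z ^ (2 * k + 1))" for z :: complex
  have dP: "(P has_field_derivative p (z\<^sup>2)) (at z)" for z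
  proof -
    have eq: "of_real (a k / real (2 * k + 1)) * (of_nat (2 * k + 1) * (1 * z ^ (2 * k)))
        = of_real (a k) * (z\<^sup>2) ^ k" for k
      unfolding power_mult [symmetric] by (simp del: of_nat_Suc of_nat_add of_nat_mult)
    show ?thesis
      unfolding P_def p_def
      by (rule DERIV_cong, (rule DERIV_sum DERIV_cmult DERIV_power DERIV_ident)+)
         (rule sum.cong, simp_all add: eq[symmetric] del: of_nat_Suc)
  qed
  have sq: "Im (z\<^sup>2) = 0" if "Re z = 0" for z :: complex
    using that by (simp add: power2_eq_square)
  have Imp: "Im (p w) = 0" if "Im w = 0" for w
    using that by (auto simp: p_def Im_power_real intro!: sum.neutral)
  have arc: "Re (f z) \<ge> \<epsilon> * Re z" if z: "cmod z = 1" "Re z \<ge> 0" for z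
  proof -
    have dD: "((\<lambda>z. f z - P z) has_field_derivative H (z\<^sup>2) - p (z\<^sup>2)) (at z)" for z
      by (intro DERIV_diff d dP)
    \<comment> \<open>the point of the imaginary axis at the height of \<open>z\<close>\<close>
    define y where "y = \<i> * of_real (Im z)"
    have y0: "Re (f y - P y) = 0"
      by (rule Re_eq_0_on_imaginary_axis[OF dD])
         (use real Imp sq in \<open>auto simp: f0 P_def y_def intro!: sum.neutral\<close>)
    obtain u where u: "u \<in> closed_segment y z"
      "Re (f z - P z) - Re (f y - P y) = Re ((H (u\<^sup>2) - p (u\<^sup>2)) * (z - y))"
      using complex_mvt_line[of y z "\<lambda>z. f z - P z", OF dD] by blast
    have zy: "z - y = of_real (Re z)"
      by (simp add: y_def complex_eq_iff)
    have "cmod y \<le> 1"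
      using abs_Im_le_cmod[of z] z by (simp add: y_def norm_mult)
    then have "closed_segment y z \<subseteq> cball 0 1"
      using z by (intro closed_segment_subset) auto
    then have "cmod (u\<^sup>2) \<le> 1"
      using u(1) by (auto simp: norm_power power_le_one)
    then have "cmod ((H (u\<^sup>2) - p (u\<^sup>2)) * (z - y)) \<le> \<delta> * Re z"
      using tail[of "u\<^sup>2"] z(2) unfolding norm_mult zy p_def
      by (intro mult_mono) (auto intro: order_trans[OF norm_ge_zero])
    then have diff: "Re (f z) \<ge> Re (P z) - \<delta> * Re z"
      using abs_Re_le_cmod[of "(H (u\<^sup>2) - p (u\<^sup>2)) * (z - y)"] u(2) y0 by simp
    define c where "c = Re (z\<^sup>2)"
    have "\<bar>c\<bar> \<le> 1"
      using abs_Re_le_cmod[of "z\<^sup>2"] z(1) by (simp add: c_def norm_power)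
    then have "Re z * (\<delta> + \<epsilon>) \<le> Re z * (\<Sum>k\<le>n. a k / real (2 * k + 1) * chebyshev_V k c)"
      using z(2) by (intro mult_left_mono kernel) auto
    also have "\<dots> = Re (P z)"
      unfolding P_def Re_sum sum_distrib_left c_def times_complex.sel Re_complex_of_real
        Im_complex_of_real Re_odd_power_unit_circle[OF z(1)]
      by (intro sum.cong) auto
    finally show ?thesis
      using diff by (simp add: algebra_simps)
  qed
  have "Re (f z - \<epsilon> * z) \<ge> 0"
  proof (rule Re_nonneg_half_disc[OF _ _ _ z])
    show "(\<lambda>z. f z - \<epsilon> * z) holomorphic_on UNIV"
      using d by (intro holomorphic_intros)
        (metis (no_types, lifting) holomorphic_onI field_differentiable_def field_differentiable_at_within)
  next
    fix z assume "Re z = 0"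
    then have "Re (f z) = 0"
      using Re_eq_0_on_imaginary_axis[OF d f0] real sq by simp
    then show "Re (f z - \<epsilon> * z) \<ge> 0"
      using \<open>Re z = 0\<close> by simp
  qed (use arc in auto)
  then have "\<epsilon> * Re z \<le> Re (f z)" by simp
  moreover have "0 < \<epsilon> * Re z" using \<epsilon> z by simp
  ultimately show ?thesis by linarith
qed

section \<open>The function $e^w(1 + \sin w)$\<close>

lemma two_power_fact_le: "2 ^ n * fact n \<le> (fact (2 * n) :: real)"
proof (induction n)
  case (Suc n)
  have "2 ^ Suc n * fact (Suc n) = (2 * real (Suc n)) * (2 ^ n * fact n)"
    by simp
  also have "\<dots> \<le> (real (2 * n + 2) * real (2 * n + 1)) * fact (2 * n)"
    using Suc.IH by (intro mult_mono) (auto simp: algebra_simps)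
  also have "\<dots> = fact (2 * Suc n)"
    by (simp add: algebra_simps)
  finally show ?case .
qed simp

text \<open>
  The power series compare term by term: $y^{2n}/(2n)! \le (y^2/2)^n/n!$.
\<close>

lemma cosh_le_exp_half_square: "cosh (y::real) \<le> exp (y\<^sup>2 / 2)"
proof (rule sums_le)
  show "y ^ (2 * n) / fact (2 * n) \<le> (y\<^sup>2 / 2) ^ n /\<^sub>R fact n" for n
  proof -
    have "y ^ (2 * n) / fact (2 * n) \<le> y ^ (2 * n) / (2 ^ n * fact n)"
      by (rule divide_left_mono[OF two_power_fact_le]) auto
    then show ?thesis
      unfolding power_mult [of y 2 n] by (simp add: power_divide field_simps)
  qed
  define c where "c n = (if even n then y ^ n /\<^sub>R fact n else 0)" for n
  have "(\<lambda>n. c (2 * n)) sums cosh y"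
  proof (subst sums_mono_reindex)
    show "strict_mono (\<lambda>n::nat. 2 * n)"
      by (simp add: strict_mono_def)
    show "c n = 0" if "n \<notin> range (\<lambda>n. 2 * n)" for n
      using that by (auto simp: c_def elim!: evenE)
    show "c sums cosh y"
      using cosh_converges[of y] by (simp add: c_def[abs_def])
  qed
  then show "(\<lambda>n. y ^ (2 * n) / fact (2 * n)) sums cosh y"
    by (simp add: c_def divide_inverse mult.commute)
qed (rule exp_converges)

text \<open>
  The function $\varphi$ to which the derivatives of the class are subordinate.
\<close>

definition dominant :: "complex \<Rightarrow> complex" where "dominant w = exp w * (1 + sin w)"

text \<open>
  With $w = x + iy$ the claim is $\sin x \cosh y > -1$, and indeed
  $\sin^2 x \cosh^2 y \le x^2 e^{y^2} \le e^{x^2 - 1} e^{y^2} < 1$.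
\<close>

lemma Re_one_plus_sin_pos:
  assumes "cmod w < 1"
  shows "0 < Re (1 + sin w)"
proof -
  define x y where "x = Re w" and "y = Im w"
  have xy: "x\<^sup>2 + y\<^sup>2 < 1"
    using assms by (simp add: cmod_def x_def y_def)
  have "(sin x * cosh y)\<^sup>2 = \<bar>sin x\<bar>\<^sup>2 * (cosh y)\<^sup>2"
    by (simp add: power_mult_distrib)
  also have "\<dots> \<le> \<bar>x\<bar>\<^sup>2 * (exp (y\<^sup>2 / 2))\<^sup>2"
    by (intro mult_mono power_mono abs_sin_x_le_abs_x cosh_le_exp_half_square) auto
  also have "\<dots> \<le> exp (x\<^sup>2 - 1) * exp (y\<^sup>2)"
    using exp_ge_add_one_self[of "x\<^sup>2 - 1"] by (intro mult_mono) (auto simp flip: exp_double)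
  also have "\<dots> = exp (x\<^sup>2 + y\<^sup>2 - 1)"
    by (simp flip: exp_add)
  also have "\<dots> < 1" using xy by simp
  finally have "\<bar>sin x * cosh y\<bar> < 1"
    by (simp add: abs_square_less_1)
  moreover have "Re (1 + sin w) = 1 + sin x * cosh y"
    by (simp add: Re_sin x_def y_def cosh_def)
  ultimately show ?thesis by linarith
qed

text \<open>
  For $w = x + iy$ in the upper half disc $e^w$ has argument $y \in (0, 1)$, and $1 + \sin w$ lies
  in the open first quadrant, so the argument of the product lies between 0 and
  $1 + \pi/2 < \pi$.
\<close>

lemma Im_dominant_pos:
  assumes w: "cmod w < 1" "Im w > 0"
  shows "Im (dominant w) > 0"
proof -
  have b: "\<bar>Re w\<bar> < 1" "Im w < 1"
    using abs_Re_le_cmod[of w] abs_Im_le_cmod[of w] w by auto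
  have "sin (Im w) > 0"
    using w b pi_gt3 by (intro sin_gt_zero) auto
  moreover have "cos (Im w) > 0" "cos (Re w) > 0"
    using w b pi_gt3 by (auto intro!: cos_gt_zero_pi)
  moreover have "Im (1 + sin w) > 0"
    using \<open>cos (Re w) > 0\<close> w by (simp add: Im_sin)
  ultimately have "0 < exp (Re w) * (cos (Im w) * Im (1 + sin w) + sin (Im w) * Re (1 + sin w))"
    using Re_one_plus_sin_pos[OF w(1)] by (intro mult_pos_pos add_pos_pos) auto
  then show ?thesis
    by (simp add: dominant_def Re_exp Im_exp algebra_simps)
qed

lemma dominant_cnj: "dominant (cnj w) = cnj (dominant w)"
  by (simp add: dominant_def exp_cnj cnj_sin)

lemma dominant_real_pos:
  assumes w: "Im w = 0"
  shows "Im (dominant w) = 0" "cmod w < 1 \<Longrightarrow> Re (dominant w) > 0"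
proof -
  have s: "Im (sin w) = 0" "sin (Im w) = 0" using w by (simp_all add: Im_sin)
  then show "Im (dominant w) = 0"
    by (simp add: dominant_def Im_exp w)
  show "Re (dominant w) > 0" if "cmod w < 1"
    using Re_one_plus_sin_pos[OF that] s
    by (simp add: dominant_def Re_exp w)
qed

text \<open>
  The product $e^w \sin w$ is a difference of exponentials at $(1 \pm i) w$, so the Taylor
  remainder of the exponential function applies. It is taken at degree 9, where each
  remainder is below $10^{-3}$; most of the error comes from the coefficients $-7/720$ and
  $-1/720$ of $w^6$ and $w^7$. What matters is that the error stays below $1/50$, the bound in
  kernel_lower_bound.
\<close>

lemma exp_one_plus_sin_tail:
  fixes w :: complex
  assumes w: "cmod w \<le> 1"
  shows "cmod (exp w * (1 + sin w) -
    (1 + 2 * w + 3/2 * w^2 + 1/2 * w^3 + 1/24 * w^4 - 1/40 * w^5)) \<le> 15/1000"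
proof -
  define T where "T u = (\<Sum>k\<le>9. u ^ k / fact k)" for u :: complex
  define R where "R u = exp u - T u" for u
  have R: "cmod (R u) \<le> 8 * 32 / 362880" if "cmod u \<le> sqrt 2" for u
  proof -
    have "sqrt 2 \<le> (2::real)"
      by (simp add: real_le_lsqrt)
    then have "exp \<bar>Re u\<bar> \<le> exp (2::real)"
      using that abs_Re_le_cmod[of u] by simp
    also have "exp (2::real) = exp 1 * exp 1"
      by (simp flip: exp_add)
    also have "\<dots> \<le> (2.75::real) * 2.75"
      by (rule mult_mono) (use e_less_272 in auto)
    finally have e: "exp \<bar>Re u\<bar> \<le> 8" by simp
    have "cmod u ^ 10 \<le> sqrt 2 ^ 10"
      using that by (intro power_mono) auto
    also have "sqrt 2 ^ 10 = (sqrt 2 ^ 2) ^ (5::nat)"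
      by (subst power_mult [symmetric]) simp
    also have "\<dots> = (32::real)" by simp
    finally have p: "cmod u ^ 10 \<le> 32" .
    have "cmod (R u) \<le> exp \<bar>Re u\<bar> * cmod u ^ Suc 9 / fact 9"
      unfolding R_def T_def by (rule Taylor_exp)
    also have "\<dots> \<le> 8 * 32 / fact 9"
      using e p by (intro divide_right_mono mult_mono) auto
    also have "fact 9 = (362880::real)"
      by (simp add: fact_numeral)
    finally show ?thesis .
  qed
  have n: "cmod (1 + \<i>) = sqrt 2" "cmod (1 - \<i>) = sqrt 2"
    by (simp_all add: cmod_def)
  have "cmod ((1 + \<i>) * w) \<le> sqrt 2" "cmod ((1 - \<i>) * w) \<le> sqrt 2" "cmod w \<le> sqrt 2"
    using w n by (auto simp: norm_mult intro: order_trans[OF w])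
  note r = this[THEN R]
  have "exp w * sin w = (exp ((1 + \<i>) * w) - exp ((1 - \<i>) * w)) / (2 * \<i>)"
    by (simp add: sin_exp_eq algebra_simps exp_add exp_diff exp_minus divide_simps)
  then have "exp w * (1 + sin w) = R w + T w +
      ((R ((1 + \<i>) * w) - R ((1 - \<i>) * w)) / (2 * \<i>) +
       (T ((1 + \<i>) * w) - T ((1 - \<i>) * w)) / (2 * \<i>))"
    by (simp add: R_def ring_distribs diff_divide_distrib)
  moreover have "T w + (T ((1 + \<i>) * w) - T ((1 - \<i>) * w)) / (2 * \<i>) =
     1 + 2 * w + 3/2 * w^2 + 1/2 * w^3 + 1/24 * w^4 - 1/40 * w^5
     - 7/720 * w^6 - 1/720 * w^7 + 1/40320 * w^8 + 17/362880 * w^9"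
  proof -
    have p: "(1 + \<i>)^2 = 2 * \<i>" "(1 + \<i>)^3 = -2 + 2 * \<i>" "(1 + \<i>)^4 = -4"
      "(1 + \<i>)^5 = -4 - 4 * \<i>" "(1 + \<i>)^6 = - 8 * \<i>" "(1 + \<i>)^7 = 8 - 8 * \<i>"
      "(1 + \<i>)^8 = 16" "(1 + \<i>)^9 = 16 + 16 * \<i>"
      by (simp_all add: eval_nat_numeral complex_eq_iff)
    have m: "(1 - \<i>)^2 = -2 * \<i>" "(1 - \<i>)^3 = -2 - 2 * \<i>" "(1 - \<i>)^4 = -4"
      "(1 - \<i>)^5 = -4 + 4 * \<i>" "(1 - \<i>)^6 = 8 * \<i>" "(1 - \<i>)^7 = 8 + 8 * \<i>"
      "(1 - \<i>)^8 = 16" "(1 - \<i>)^9 = 16 - 16 * \<i>"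
      by (simp_all add: eval_nat_numeral complex_eq_iff)
    have T: "T u = 1 + u + u^2/2 + u^3/6 + u^4/24 + u^5/120 + u^6/720 + u^7/5040
        + u^8/40320 + u^9/362880" for u
      unfolding T_def atMost_nat_numeral by (simp add: fact_numeral atMost_nat_numeral)
    show ?thesis
      unfolding T power_mult_distrib p m by (simp add: field_simps)
  qed
  ultimately have "exp w * (1 + sin w) -
      (1 + 2 * w + 3/2 * w^2 + 1/2 * w^3 + 1/24 * w^4 - 1/40 * w^5) =
      R w + (R ((1 + \<i>) * w) - R ((1 - \<i>) * w)) / (2 * \<i>)
      + (1/40320 * w^8 + 17/362880 * w^9 - 7/720 * w^6 - 1/720 * w^7)" (is "?d = ?A + ?B + ?C")
    by (simp add: algebra_simps)
  moreover have "cmod ?B \<le> 8 * 32 / 362880"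
    using r norm_triangle_ineq4[of "R ((1 + \<i>) * w)" "R ((1 - \<i>) * w)"]
    by (simp add: norm_divide norm_mult)
  moreover have "cmod ?C \<le> (1/40320 + 17/362880) + 7/720 + 1/720"
  proof -
    have "cmod (w ^ k) \<le> 1" for k
      using w by (simp add: norm_power power_le_one)
    then show ?thesis
      by (intro norm_triangle_le norm_triangle_le_diff add_mono) (auto simp: norm_mult norm_divide)
  qed
  ultimately show ?thesis
    using r(3) norm_triangle_ineq[of "?A + ?B" ?C] norm_triangle_ineq[of ?A ?B] by simp
qed

lemma sum_nth_dominant:
  fixes w :: complex
  shows "(\<Sum>k\<le>5. complex_of_real ([1, 2, 3/2, 1/2, 1/24, -1/40] ! k) * w ^ k) =
    1 + 2 * w + 3/2 * w^2 + 1/2 * w^3 + 1/24 * w^4 - 1/40 * w^5"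
    "(\<Sum>k\<le>5. complex_of_real ([1, -2, 3/2, -1/2, 1/24, 1/40] ! k) * w ^ k) =
    1 - 2 * w + 3/2 * w^2 - 1/2 * w^3 + 1/24 * w^4 + 1/40 * w^5"
  by (simp_all add: atMost_nat_numeral atMost_Suc algebra_simps)

text \<open>
  The two lists are the Taylor coefficients of $\varphi(w)$ and $\varphi(-w)$ up to degree 5. The
  first polynomial has its minimum very close to $c = -1/2$; in powers of $u = c + 1/2$ it is a
  constant of about $0.0266$, a tiny linear term, and $u^2$ times a positive factor. The second
  polynomial is not tight, and expanding it around $c = 1/2$ works in the same way.
\<close>

lemma kernel_lower_bound:
  fixes c :: real
  assumes "-1 \<le> c" "c \<le> 1"
  shows "1/50 \<le> (\<Sum>k\<le>5. ([1, 2, 3/2, 1/2, 1/24, -1/40] ! k) / real (2 * k + 1) * chebyshev_V k c)"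
    and "1/50 \<le> (\<Sum>k\<le>5. ([1, -2, 3/2, -1/2, 1/24, 1/40] ! k) / real (2 * k + 1) * chebyshev_V k c)"
proof -
  have 1: "(\<Sum>k\<le>5. ([1, 2, 3/2, 1/2, 1/24, -1/40] ! k) / real (2 * k + 1) * chebyshev_V k c) =
     2209/83160 - 13/8316 * u + u\<^sup>2 * ((1229/6930 + 425/2079 * u) + u\<^sup>2 * (434/1485 - 4/55 * u))"
    if "c = u - 1/2" for u
    unfolding that by (simp add: eval_nat_numeral field_simps)
  have 2: "(\<Sum>k\<le>5. ([1, -2, 3/2, -1/2, 1/24, 1/40] ! k) / real (2 * k + 1) * chebyshev_V k c) =
     2383/3080 + 1739/2772 * u + u\<^sup>2 * ((449/770 + 1469/3465 * u) + u\<^sup>2 * (326/1485 - 4/55 * u))"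
    if "c = 1/2 - u" for u
    unfolding that by (simp add: eval_nat_numeral field_simps)
  define u where "u = c + 1/2"
  have u: "-1/2 \<le> u" "u \<le> 3/2" "c = u - 1/2" using assms by (auto simp: u_def)
  have "0 \<le> u\<^sup>2 * ((1229/6930 + 425/2079 * u) + u\<^sup>2 * (434/1485 - 4/55 * u))"
  proof (intro mult_nonneg_nonneg add_nonneg_nonneg[of "_ + _"])
    show "0 \<le> 1229/6930 + 425/2079 * u" "0 \<le> 434/1485 - 4/55 * u"
      using u by linarith+
  qed auto
  then show "1/50 \<le> (\<Sum>k\<le>5. ([1, 2, 3/2, 1/2, 1/24, -1/40] ! k) / real (2 * k + 1) * chebyshev_V k c)"
    unfolding 1[OF u(3)] using u by linarith
  define v where "v = 1/2 - c"
  have v: "-1/2 \<le> v" "v \<le> 3/2" "c = 1/2 - v" using assms by (auto simp: v_def)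
  have "0 \<le> v\<^sup>2 * ((449/770 + 1469/3465 * v) + v\<^sup>2 * (326/1485 - 4/55 * v))"
  proof (intro mult_nonneg_nonneg add_nonneg_nonneg[of "_ + _"])
    show "0 \<le> 449/770 + 1469/3465 * v" "0 \<le> 326/1485 - 4/55 * v"
      using v by linarith+
  qed auto
  then show "1/50 \<le> (\<Sum>k\<le>5. ([1, -2, 3/2, -1/2, 1/24, 1/40] ! k) / real (2 * k + 1) * chebyshev_V k c)"
    unfolding 2[OF v(3)] using v by linarith
qed

section \<open>Univalence of the extremal function\<close>

text \<open>
  The Noshiro--Warschawski criterion. The set is not required to be open, so that half-axes are
  covered, which is why the derivative is taken in the full neighbourhood of each point.
\<close>

lemma inj_on_convex_Re_deriv_pos:
  assumes "convex S"
    and d: "\<And>z. z \<in> S \<Longrightarrow> (f has_field_derivative f' z) (at z)"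
    and pos: "\<And>z. z \<in> S \<Longrightarrow> Re (a * f' z) > 0"
  shows "inj_on f S"
proof (rule inj_onI, rule ccontr)
  fix x y assume xy: "x \<in> S" "y \<in> S" "f x = f y" "x \<noteq> y"
  have seg: "closed_segment x y \<subseteq> S"
    using xy assms(1) by (simp add: closed_segment_subset)
  define c where "c = a / (y - x)"
  have "((\<lambda>z. c * f z) has_field_derivative c * f' z) (at z)" if "z \<in> closed_segment x y" for z
    using d seg that by (intro DERIV_cmult) auto
  from complex_mvt_line[of x y, OF this]
  obtain u where u: "u \<in> closed_segment x y" "0 = Re (c * f' u * (y - x))"
    using xy by auto
  have "c * f' u * (y - x) = a * f' u"
    using xy by (simp add: c_def)
  with u pos[of u] seg show False by auto
qed

lemma ex_extremal:
  obtains f where "\<And>z. (f has_field_derivative dominant (z\<^sup>2)) (at z)" "f 0 = 0"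
proof -
  have "(\<lambda>z. dominant (z\<^sup>2)) holomorphic_on UNIV"
    unfolding dominant_def by (intro holomorphic_intros)
  from holomorphic_convex_primitive'[OF convex_UNIV open_UNIV this]
  obtain g where g: "\<And>z. (g has_field_derivative dominant (z\<^sup>2)) (at z)" by auto
  show thesis
  proof (rule that[of "\<lambda>z. g z - g 0"])
    show "((\<lambda>z. g z - g 0) has_field_derivative dominant (z\<^sup>2)) (at z)" for z
      using DERIV_diff[OF g DERIV_const[of "g 0"]] by simp
  qed simp
qed

context
  fixes f
  assumes d: "\<And>z. (f has_field_derivative dominant (z\<^sup>2)) (at z)" and f0: "f 0 = 0"
begin

lemma Re_extremal_pos:
  assumes z: "cmod z < 1" "Re z > 0"
  shows "Re (f z) > 0"
proof (rule Re_pos_odd_primitive[OF d f0 _ _ _ _ z])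
  show "Im (dominant w) = 0" if "Im w = 0" for w
    using dominant_real_pos[OF that] by simp
  show "cmod (dominant w - (\<Sum>k\<le>5. of_real ([1, 2, 3/2, 1/2, 1/24, -1/40] ! k) * w ^ k)) \<le> 15/1000"
    if "cmod w \<le> 1" for w
    using exp_one_plus_sin_tail[OF that] unfolding sum_nth_dominant dominant_def .
  show "15/1000 + 5/1000 \<le> (\<Sum>k\<le>5. ([1, 2, 3/2, 1/2, 1/24, -1/40] ! k) / real (2 * k + 1) * chebyshev_V k c)"
    if "-1 \<le> c" "c \<le> 1" for c
    using kernel_lower_bound(1)[OF that] by simp
qed auto

text \<open>
  The function $-i f(iz)$ is the primitive of $\varphi(-z^2)$, so this is the same criterion on the
  half disc turned by a right angle.
\<close>

lemma Im_extremal_pos: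
  assumes z: "cmod z < 1" "Im z > 0"
  shows "Im (f z) > 0"
proof -
  define g where "g z = - \<i> * f (\<i> * z)" for z
  have d': "(g has_field_derivative dominant (- (z\<^sup>2))) (at z)" for z
  proof -
    have "((\<lambda>z. f (\<i> * z)) has_field_derivative dominant ((\<i> * z)\<^sup>2) * \<i>) (at z)"
      by (rule DERIV_chain2[OF d]) (auto intro!: derivative_eq_intros)
    from DERIV_cmult[OF this, of "- \<i>"] show ?thesis
      by (simp add: g_def[abs_def] power_mult_distrib algebra_simps)
  qed
  have "Re (g (- \<i> * z)) > 0"
  proof (rule Re_pos_odd_primitive[of g "\<lambda>w. dominant (- w)", OF d'])
    show "Im (dominant (- w)) = 0" if "Im w = 0" for w
      using dominant_real_pos[of "- w"] that by simp
    show "cmod (dominant (- w) - (\<Sum>k\<le>5. of_real ([1, -2, 3/2, -1/2, 1/24, 1/40] ! k) * w ^ k)) \<le> 15/1000"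
      if "cmod w \<le> 1" for w
      using exp_one_plus_sin_tail[of "- w"] that unfolding sum_nth_dominant dominant_def by simp
    show "15/1000 + 5/1000 \<le> (\<Sum>k\<le>5. ([1, -2, 3/2, -1/2, 1/24, 1/40] ! k) / real (2 * k + 1) * chebyshev_V k c)"
      if "-1 \<le> c" "c \<le> 1" for c
      using kernel_lower_bound(2)[OF that] by simp
  qed (use z in \<open>auto simp: g_def f0 norm_mult\<close>)
  then show ?thesis by (simp add: g_def)
qed

lemma extremal_odd: "f (- z) = - f z"
proof -
  have "((\<lambda>z. f z + f (- z)) has_field_derivative 0) (at z)" for z
  proof -
    have "((\<lambda>z. f (- z)) has_field_derivative dominant ((- z)\<^sup>2) * (- 1)) (at z)"
      by (rule DERIV_chain2[OF d]) (auto intro!: derivative_eq_intros)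
    from DERIV_add[OF d this] show ?thesis by simp
  qed
  then have "(\<lambda>z. f z + f (- z)) constant_on UNIV"
    by (intro has_field_derivative_0_imp_constant_on) auto
  then have "f z + f (- z) = f 0 + f (- 0)"
    unfolding constant_on_def by (metis UNIV_I)
  then show ?thesis using f0 by (simp add: eq_neg_iff_add_eq_0 add.commute)
qed

text \<open>
  Points with the same image have the same pair of signs of real and imaginary part, and the
  points of the disc with given signs form a convex set on which $f'$ stays in a half-plane.
\<close>

lemma inj_on_extremal: "inj_on f (ball 0 1)"
proof (rule inj_onI)
  have axes: "Re (f z) = 0" if "Re z = 0" for z
    by (rule Re_eq_0_on_imaginary_axis[OF d f0 _ that])
       (use dominant_real_pos in \<open>auto simp: power2_eq_square\<close>)
  have axes': "Im (f z) = 0" if "Im z = 0" for z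
  proof -
    obtain u where u: "u \<in> closed_segment 0 z"
      "Re (- \<i> * f z) - Re (- \<i> * f 0) = Re (- \<i> * dominant (u\<^sup>2) * (z - 0))"
      using complex_mvt_line[of 0 z "\<lambda>z. - \<i> * f z" "\<lambda>z. - \<i> * dominant (z\<^sup>2)"] DERIV_cmult[OF d] by blast
    have "Im u = 0" using u(1) that by (auto simp: closed_segment_def)
    then show ?thesis
      using u(2) that f0 dominant_real_pos(1)[of "u\<^sup>2"] by (simp add: power2_eq_square)
  qed
  have sRe: "sgn (Re (f z)) = sgn (Re z)" if "cmod z < 1" for z
    using Re_extremal_pos[of z] Re_extremal_pos[of "- z"] axes[of z] that
    by (cases "Re z" "0::real" rule: linorder_cases) (auto simp: extremal_odd)
  have sIm: "sgn (Im (f z)) = sgn (Im z)" if "cmod z < 1" for z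
    using Im_extremal_pos[of z] Im_extremal_pos[of "- z"] axes'[of z] that
    by (cases "Im z" "0::real" rule: linorder_cases) (auto simp: extremal_odd)
  fix x y assume xy: "x \<in> ball 0 1" "y \<in> ball 0 1" "f x = f y"
  \<comment> \<open>an open quadrant, an open half-axis or the origin, according to the signs \<open>a\<close> and \<open>b\<close>\<close>
  define S where "S a b = ball 0 1 \<inter> {z. sgn (Re z) = a} \<inter> {z. sgn (Im z) = b}" for a b :: real
  have "x \<in> S (sgn (Re x)) (sgn (Im x))" "y \<in> S (sgn (Re x)) (sgn (Im x))"
    using xy sRe[of x] sRe[of y] sIm[of x] sIm[of y] by (auto simp: S_def)
  moreover have "inj_on f (S a b)" for a b
  proof (rule inj_on_convex_Re_deriv_pos[where a = "if a * b = 0 then 1 else - \<i> * of_real (a * b)", OF _ d])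
    have "{z. sgn (Re z) = a} = (if a = 1 then {z. Re z > 0} else if a = -1 then {z. Re z < 0}
        else if a = 0 then {z. Re z = 0} else {})"
      by (auto simp: sgn_real_def split: if_splits)
    then have 1: "convex {z. sgn (Re z) = a}"
      using convex_halfspace_Re_gt[of 0] convex_halfspace_Re_lt[of 0] by (auto simp: convex_def)
    have "{z. sgn (Im z) = b} = (if b = 1 then {z. Im z > 0} else if b = -1 then {z. Im z < 0}
        else if b = 0 then {z. Im z = 0} else {})"
      by (auto simp: sgn_real_def split: if_splits)
    then have 2: "convex {z. sgn (Im z) = b}"
      using convex_halfspace_Im_gt[of 0] convex_halfspace_Im_lt[of 0] by (auto simp: convex_def)
    show "convex (S a b)"
      unfolding S_def by (intro convex_Int 1 2 convex_ball)
    show "0 < Re ((if a * b = 0 then 1 else - \<i> * of_real (a * b)) * dominant (z\<^sup>2))" if "z \<in> S a b" for z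
    proof -
      have z: "cmod (z\<^sup>2) < 1"
        using that by (auto simp: S_def norm_power abs_square_less_1)
      \<comment> \<open>as \<open>Im (z\<^sup>2) = 2 * Re z * Im z\<close>\<close>
      have ab: "sgn (Im (z\<^sup>2)) = a * b"
        using that by (auto simp: S_def power2_eq_square sgn_mult)
      define v where "v = z\<^sup>2"
      have v: "cmod v < 1" "a * b = sgn (Im v)"
        using z ab by (simp_all add: v_def)
      have "0 < Re ((if sgn (Im v) = 0 then 1 else - \<i> * of_real (sgn (Im v))) * dominant v)"
      proof (cases "Im v" "0::real" rule: linorder_cases)
        case equal
        then show ?thesis using dominant_real_pos(2)[OF _ v(1)] by simp
      next
        case greater
        then show ?thesis using Im_dominant_pos[OF v(1)] by simp
      next
        case less
        then show ?thesis using Im_dominant_pos[of "cnj v"] v(1) dominant_cnj[of v] by simp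
      qed
      then show ?thesis unfolding v(2) v_def .
    qed
  qed
  ultimately show "x = y"
    using xy(3) by (meson inj_onD)
qed

end

section \<open>The sharp bound\<close>

theorem theorem3p5:
  shows "(\<forall>f\<in>class_P_star. cmod (log_hankel_2_1 f) \<le> 1 / 9) \<and>
         (\<exists>f\<in>class_P_star. cmod (log_hankel_2_1 f) = 1 / 9)"
proof
  show "\<forall>f\<in>class_P_star. cmod (log_hankel_2_1 f) \<le> 1 / 9"
  proof
    fix f assume "f \<in> class_P_star"
    then obtain w where f: "f \<in> class_S" and w: "schwarz_function w"
      and eq: "\<And>z. z \<in> \<bbbD> \<Longrightarrow> deriv f z = exp (w z) * (1 + sin (w z))"
      by (auto simp: class_P_star_def subordinate_def)
    define W where "W = fps_expansion w 0"
    have W: "w has_fps_expansion W"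
      unfolding W_def using w
      by (intro has_fps_expansion_fps_expansion[OF open_ball]) (auto simp: schwarz_function_def)
    obtain c x y :: complex where cxy: "cmod c \<le> 1" "cmod x \<le> 1" "cmod y \<le> 1 - (cmod x)\<^sup>2"
      and nth: "fps_nth W 1 = c" "fps_nth W 2 = (1 - (cmod c)\<^sup>2) * x"
      "fps_nth W 3 = (1 - (cmod c)\<^sup>2) * (y - cnj c * x\<^sup>2)"
      using schwarz_function_coeffs[OF w W] by metis
    have "log_hankel_2_1 f = fps_nth W 1 * fps_nth W 3 / 8 + (fps_nth W 1)\<^sup>2 * fps_nth W 2 / 48
        - fps_nth W 1 ^ 4 / 96 - (fps_nth W 2)\<^sup>2 / 9"
      by (rule log_hankel_eq[OF f w W]) (rule eq)
    then show "cmod (log_hankel_2_1 f) \<le> 1 / 9"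
      using hankel_functional_bound[OF cxy] unfolding nth by simp
  qed
next
  obtain f where d: "\<And>z. (f has_field_derivative dominant (z\<^sup>2)) (at z)" and f0: "f 0 = 0"
    using ex_extremal by blast
  have deriv: "deriv f z = dominant (z\<^sup>2)" for z
    using d by (rule DERIV_imp_deriv)
  have "f holomorphic_on \<bbbD>"
    unfolding holomorphic_on_def field_differentiable_def
    using d has_field_derivative_at_within by blast
  then have f: "f \<in> class_S"
    by (simp add: class_S_def f0 deriv dominant_def inj_on_extremal[OF d f0])
  have w: "schwarz_function (\<lambda>z. z\<^sup>2)"
    unfolding schwarz_function_def
    by (auto intro!: holomorphic_intros simp: norm_power abs_square_less_1)
  have W: "(\<lambda>z::complex. z\<^sup>2) has_fps_expansion fps_X ^ 2"
    by (rule has_fps_expansion_fps_X_power)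
  have "log_hankel_2_1 f = - 1 / 9"
    by (subst log_hankel_eq[OF f w W]) (auto simp: deriv dominant_def fps_X_power_nth)
  moreover have "f \<in> class_P_star"
    unfolding class_P_star_def subordinate_def using f w deriv by (auto simp: dominant_def)
  ultimately show "\<exists>f\<in>class_P_star. cmod (log_hankel_2_1 f) = 1 / 9"
    by (intro bexI[of _ f]) simp_all
qed

end
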